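(* Let $r\geq 3$ and $E=\{x_1,\dots,x_r,y_1,\dots,y_r,t\}$ (a set of $2r+1$ distinct elements), and put $Y=\{y_1,\dots,y_r\}$. Define $\varphi_1=\{\{t,x_i,y_i\}:1\leq i\leq r\}$; $\varphi_2=\{\{x_i,y_i,x_j,y_j\}:1\leq i<j\leq r\}$; $\varphi_3=\{Z\subseteq E: |Z|=r,\ |Z\cap Y| \text{ is odd, and } |Z\cap\{x_i,y_i\}|=1 \text{ for all } 1\leq i\leq r\}$; $\varphi_4=\{E-C: C\in\varphi_3\}$ if $r$ is odd, and $\varphi_4=\{(E-C)\,\Delta\,\{x_{r-1},y_{r-1}\}: C\in\varphi_3\}$ if $r$ is even. If $M$ is a matroid on $E$ whose collection of circuits is exactly $\varphi_1\cup\varphi_2\cup\varphi_3\cup\varphi_4$, then $M$ is the rank-$r$ binary spike, i.e. $M$ is a binary matroid which is a rank-$r$ spike with tip $t$ and legs $\{t,x_i,y_i\}$, $1\le i\le r$.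
   Context: Rank-$r$ spike ($r\ge 3$): on $E=\{x_1,\dots,x_r,y_1,\dots,y_r,t\}$, let $\mathcal C_1=\{\{t,x_i,y_i\}\}$, $\mathcal C_2=\{\{x_i,y_i,x_j,y_j\}:i<j\}$, let $\mathcal C_3$ be a (possibly empty) family of sets $\{z_1,\dots,z_r\}$ with $z_i\in\{x_i,y_i\}$ for all $i$, no two of which share more than $r-2$ elements, and let $\mathcal C_4$ be all $(r+1)$-element subsets of $E$ containing no member of $\mathcal C_1\cup\mathcal C_2\cup\mathcal C_3$. A matroid on $E$ with circuit set $\mathcal C_1\cup\mathcal C_2\cup\mathcal C_3\cup\mathcal C_4$ is a rank-$r$ spike with tip $t$ and legs $L_i=\{t,x_i,y_i\}$. The rank-$r$ binary spike $Z_r$ is the vector matroid over $GF(2)$ of the $r\times(2r+1)$ matrix $[I_r\,|\,J_r-I_r\,|\,\mathbf 1]$ ($J_r$ the all-ones $r\times r$ matrix, $\mathbf 1$ the all-ones column), with columns labeled in order $x_1,\dots,x_r,y_1,\dots,y_r,t$; for each $r\ge3$ it is the unique binary rank-$r$ spike. *)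

theory Defs
  imports "Jordan_Normal_Form.VS_Connect" "HOL-Library.Z2"
begin

section \<open>Matroids\<close>

record 'a indep_system =
  ground :: "'a set"
  indep :: "'a set set"

locale matroid =
  fixes M :: "'a indep_system"
  assumes finite_ground: "finite (ground M)"
    and indep_subset: "X \<in> indep M \<Longrightarrow> X \<subseteq> ground M"
    and empty_indep: "{} \<in> indep M"
    and indep_downward: "Y \<in> indep M \<Longrightarrow> X \<subseteq> Y \<Longrightarrow> X \<in> indep M"
    and augmentation: "X \<in> indep M \<Longrightarrow> Y \<in> indep M \<Longrightarrow> card X < card Y \<Longrightarrow>
      \<exists>e\<in>Y - X. insert e X \<in> indep M"

definition circuits :: "'a indep_system \<Rightarrow> 'a set set" where
  "circuits M = {C. C \<subseteq> ground M \<and> C \<notin> indep M \<and> (\<forall>D. D \<subset> C \<longrightarrow> D \<in> indep M)}"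

text \<open>
  The vector matroid of a matrix \<open>A\<close> over a field whose \<open>j\<close>-th column carries the label \<open>ls ! j\<close>
  (meaningful when \<open>ls\<close> is distinct and has one entry per column).  Since \<open>lin_dep\<close> speaks about
  sets of vectors, injectivity is needed to make repeated columns dependent.
\<close>

definition vector_matroid :: "'f::field mat \<Rightarrow> 'a list \<Rightarrow> 'a indep_system" where
  "vector_matroid A ls = \<lparr>
     ground = set ls,
     indep = {(!) ls ` J | J. J \<subseteq> {..<dim_col A} \<and> inj_on (col A) J \<and>
       \<not> LinearCombinations.module.lin_dep class_ring (module_vec TYPE('f) (dim_row A)) (col A ` J)}\<rparr>"

text \<open>
  Since the labels range over all enumerations of the ground set, equality with a labelled vector
  matroid expresses isomorphism with the vector matroid of \<open>A\<close>.
\<close>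

definition binary_matroid :: "'a indep_system \<Rightarrow> bool" where
  "binary_matroid M \<longleftrightarrow> (\<exists>(A :: bit mat) ls. distinct ls \<and> length ls = dim_col A \<and>
     M = vector_matroid A ls)"


section \<open>Spikes\<close>

definition spike_labels :: "nat \<Rightarrow> (nat \<Rightarrow> 'a) \<Rightarrow> (nat \<Rightarrow> 'a) \<Rightarrow> 'a \<Rightarrow> 'a list" where
  "spike_labels r x y t = map x [1..<Suc r] @ map y [1..<Suc r] @ [t]"

definition spike_ground :: "nat \<Rightarrow> (nat \<Rightarrow> 'a) \<Rightarrow> (nat \<Rightarrow> 'a) \<Rightarrow> 'a \<Rightarrow> 'a set" where
  "spike_ground r x y t = x ` {1..r} \<union> y ` {1..r} \<union> {t}"

definition spike_legs :: "nat \<Rightarrow> (nat \<Rightarrow> 'a) \<Rightarrow> (nat \<Rightarrow> 'a) \<Rightarrow> 'a \<Rightarrow> 'a set set" where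
  "spike_legs r x y t = {{t, x i, y i} | i. i \<in> {1..r}}"

definition spike_leg_pairs :: "nat \<Rightarrow> (nat \<Rightarrow> 'a) \<Rightarrow> (nat \<Rightarrow> 'a) \<Rightarrow> 'a set set" where
  "spike_leg_pairs r x y = {{x i, y i, x j, y j} | i j. 1 \<le> i \<and> i < j \<and> j \<le> r}"

definition spike_transversals :: "nat \<Rightarrow> (nat \<Rightarrow> 'a) \<Rightarrow> (nat \<Rightarrow> 'a) \<Rightarrow> 'a set set" where
  "spike_transversals r x y = {z ` {1..r} | z. \<forall>i\<in>{1..r}. z i \<in> {x i, y i}}"

definition spike_rest ::
  "nat \<Rightarrow> (nat \<Rightarrow> 'a) \<Rightarrow> (nat \<Rightarrow> 'a) \<Rightarrow> 'a \<Rightarrow> 'a set set \<Rightarrow> 'a set set" where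
  "spike_rest r x y t C3 = {C. C \<subseteq> spike_ground r x y t \<and> card C = r + 1 \<and>
     (\<forall>D \<in> spike_legs r x y t \<union> spike_leg_pairs r x y \<union> C3. \<not> D \<subseteq> C)}"

text \<open>\<open>M\<close> is a rank-\<open>r\<close> spike with tip \<open>t\<close> and legs \<open>{t, x i, y i}\<close> for \<open>1 \<le> i \<le> r\<close>.\<close>

definition is_spike ::
  "nat \<Rightarrow> (nat \<Rightarrow> 'a) \<Rightarrow> (nat \<Rightarrow> 'a) \<Rightarrow> 'a \<Rightarrow> 'a indep_system \<Rightarrow> bool" where
  "is_spike r x y t M \<longleftrightarrow>
     r \<ge> 3 \<and> distinct (spike_labels r x y t) \<and>
     matroid M \<and> ground M = spike_ground r x y t \<and>
     (\<exists>C3. C3 \<subseteq> spike_transversals r x y \<and>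
        (\<forall>Z\<in>C3. \<forall>Z'\<in>C3. Z \<noteq> Z' \<longrightarrow> card (Z \<inter> Z') \<le> r - 2) \<and>
        circuits M = spike_legs r x y t \<union> spike_leg_pairs r x y \<union> C3 \<union> spike_rest r x y t C3)"

text \<open>The matrix with blocks \<open>I\<close>, \<open>J - I\<close> and an all-ones column.\<close>

definition binary_spike_mat :: "nat \<Rightarrow> bit mat" where
  "binary_spike_mat r = mat_of_cols r
     (cols (1\<^sub>m r) @ cols (mat r r (\<lambda>_. 1) - 1\<^sub>m r) @ [vec r (\<lambda>_. 1)])"

definition binary_spike ::
  "nat \<Rightarrow> (nat \<Rightarrow> 'a) \<Rightarrow> (nat \<Rightarrow> 'a) \<Rightarrow> 'a \<Rightarrow> 'a indep_system" where
  "binary_spike r x y t = vector_matroid (binary_spike_mat r) (spike_labels r x y t)"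


section \<open>The prescribed circuits\<close>

definition phi3 :: "nat \<Rightarrow> (nat \<Rightarrow> 'a) \<Rightarrow> (nat \<Rightarrow> 'a) \<Rightarrow> 'a \<Rightarrow> 'a set set" where
  "phi3 r x y t = {Z. Z \<subseteq> spike_ground r x y t \<and> card Z = r \<and> odd (card (Z \<inter> y ` {1..r})) \<and>
     (\<forall>i\<in>{1..r}. card (Z \<inter> {x i, y i}) = 1)}"

definition phi4 :: "nat \<Rightarrow> (nat \<Rightarrow> 'a) \<Rightarrow> (nat \<Rightarrow> 'a) \<Rightarrow> 'a \<Rightarrow> 'a set set" where
  "phi4 r x y t =
     (if odd r then {spike_ground r x y t - C | C. C \<in> phi3 r x y t}
      else {sym_diff (spike_ground r x y t - C) {x (r - 1), y (r - 1)} | C. C \<in> phi3 r x y t})"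

end

theory Submission
  imports Defs
begin

text \<open>
  A matroid is determined by its circuits, so it suffices to find the minimal nonempty sets of
  columns of the binary spike matrix with sum zero. The column of \<open>x\<^sub>i\<close> is the unit vector \<open>e\<^sub>i\<close>,
  that of \<open>t\<close> is the all-ones vector \<open>1\<close>, and that of \<open>y\<^sub>i\<close> is \<open>e\<^sub>i + 1\<close>. Hence the columns in \<open>K\<close> sum
  to zero iff for every \<open>i\<close> the number of elements of \<open>K\<close> among \<open>x\<^sub>i, y\<^sub>i\<close> has the same parity as
  \<open>|K \<inter> Y| + [t \<in> K]\<close>. If that parity is even, \<open>K\<close> is a union of pairs \<open>{x\<^sub>i, y\<^sub>i}\<close>, with \<open>t\<close> added
  iff their number is odd, and contains a leg or a union of two pairs. If it is odd, \<open>K\<close> is a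
  transversal of the pairs with \<open>|K \<inter> Y|\<close> odd, or \<open>t\<close> together with one with \<open>|K \<inter> Y|\<close> even.
\<close>

section \<open>Linear independence of columns over GF(2)\<close>

text \<open>Coefficients in GF(2) are 0 or 1, so a linear combination is the sum of the columns with
  coefficient 1. Repeated columns are caught by two-element sets \<open>K\<close>.\<close>

lemma bit_cols_independent_iff:
  fixes A :: "bit mat"
  assumes J: "J \<subseteq> {..<dim_col A}"
  shows "inj_on (col A) J \<and>
      \<not> LinearCombinations.module.lin_dep class_ring (module_vec TYPE(bit) (dim_row A)) (col A ` J) \<longleftrightarrow>
    (\<forall>K\<subseteq>J. K \<noteq> {} \<longrightarrow> (\<exists>i<dim_row A. (\<Sum>j\<in>K. col A j $ i) \<noteq> 0))"
proof -
  let ?n = "dim_row A"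
  interpret vec_space "TYPE(bit)" ?n .
  have finJ: "finite J"
    using J finite_subset by blast
  have cols_carrier: "col A ` K \<subseteq> carrier_vec ?n" for K
    by auto
  show ?thesis
  proof (intro iffI allI impI)
    fix K assume ind: "inj_on (col A) J \<and> lin_indpt (col A ` J)" and K: "K \<subseteq> J" "K \<noteq> {}"
    have inj: "inj_on (col A) K" using ind K inj_on_subset by blast
    show "\<exists>i<?n. (\<Sum>j\<in>K. col A j $ i) \<noteq> 0"
    proof (rule ccontr)
      assume "\<not> ?thesis"
      then have zero: "(\<Sum>j\<in>K. col A j $ i) = 0" if "i < ?n" for i
        using that by blast
      \<comment> \<open>The constant coefficient 1 turns the vanishing sum into a linear dependence;
        injectivity identifies the sum over column vectors with the sum over indices.\<close>
      have "lincomb (\<lambda>_. 1) (col A ` K) = 0\<^sub>v ?n"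
      proof (rule eq_vecI)
        show "dim_vec (lincomb (\<lambda>_. 1) (col A ` K)) = dim_vec (0\<^sub>v ?n)"
          using lincomb_dim[OF finite_imageI[OF finite_subset[OF K(1) finJ]] cols_carrier] by simp
        fix i assume "i < dim_vec (0\<^sub>v ?n :: bit vec)"
        then have i: "i < ?n" by simp
        show "lincomb (\<lambda>_. 1) (col A ` K) $ i = 0\<^sub>v ?n $ i"
          by (simp only: lincomb_index[OF i cols_carrier] sum.reindex[OF inj] o_def mult_1 zero[OF i]
              index_zero_vec(1)[OF i])
      qed
      moreover obtain k where "k \<in> K" using K by blast
      ultimately have "lin_dep (col A ` J)"
        unfolding lin_dep_def using K finite_subset[OF K(1) finJ]
        by (intro exI[of _ "col A ` K"] exI[of _ "\<lambda>_. 1"] exI[of _ "col A k"])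
          auto
      with ind show False by blast
    qed
  next
    assume R: "\<forall>K\<subseteq>J. K \<noteq> {} \<longrightarrow> (\<exists>i<?n. (\<Sum>j\<in>K. col A j $ i) \<noteq> 0)"
    have inj: "inj_on (col A) J"
    proof (rule inj_onI, rule ccontr)
      fix j k assume jk: "j \<in> J" "k \<in> J" "col A j = col A k" "j \<noteq> k"
      \<comment> \<open>Two equal entries add up to zero in characteristic 2.\<close>
      then have "(\<Sum>l\<in>{j, k}. col A l $ i) = 0" for i
        by (simp flip: mult_2)
      with R jk show False by (metis empty_subsetI insert_not_empty insert_subset)
    qed
    moreover have "\<not> lin_dep (col A ` J)"
    proof
      assume "lin_dep (col A ` J)"
      then obtain B a v where B: "finite B" "B \<subseteq> col A ` J" "lincomb a B = 0\<^sub>v ?n" "v \<in> B" "a v \<noteq> 0"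
        unfolding lin_dep_def by auto
      \<comment> \<open>The support of the dependence, pulled back to indices; on it every
        coefficient equals 1.\<close>
      define K where "K = {j\<in>J. col A j \<in> B \<and> a (col A j) \<noteq> 0}"
      have "K \<subseteq> J" "K \<noteq> {}" using B by (auto simp: K_def)
      then obtain i where i: "i < ?n" "(\<Sum>j\<in>K. col A j $ i) \<noteq> 0"
        using R by blast
      have image_K: "col A ` K = {w\<in>B. a w \<noteq> 0}"
        using B(2) unfolding K_def by blast
      have "inj_on (col A) K" using inj \<open>K \<subseteq> J\<close> inj_on_subset by blast
      then have "(\<Sum>j\<in>K. col A j $ i) = (\<Sum>w\<in>col A ` K. w $ i)"
        by (simp add: sum.reindex)
      also have "\<dots> = (\<Sum>w\<in>col A ` K. a w * w $ i)"
        by (rule sum.cong) (auto simp: K_def)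
      also have "\<dots> = (\<Sum>w\<in>B. a w * w $ i)"
        using B(1) unfolding image_K by (intro sum.mono_neutral_left) auto
      also have "\<dots> = lincomb a B $ i"
        using lincomb_index[OF i(1)] B(2) cols_carrier by (metis subset_trans)
      finally show False using B(3) i by simp
    qed
    ultimately show "inj_on (col A) J \<and> lin_indpt (col A ` J)" by blast
  qed
qed

text \<open>Moves the criterion from column indices to labels, which \<open>(!) ls\<close> matches
  bijectively. The function \<open>w\<close> gives the column belonging to a label, so later
  computations avoid list positions.\<close>

lemma indep_bit_vector_matroid_iff:
  fixes A :: "bit mat" and w :: "'a \<Rightarrow> nat \<Rightarrow> bit"
  assumes ls: "distinct ls" "length ls = dim_col A"
    and w: "\<And>i j. i < dim_row A \<Longrightarrow> j < dim_col A \<Longrightarrow> w (ls ! j) i = A $$ (i, j)"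
  shows "X \<in> indep (vector_matroid A ls) \<longleftrightarrow>
    X \<subseteq> set ls \<and> (\<forall>K\<subseteq>X. K \<noteq> {} \<longrightarrow> (\<exists>i<dim_row A. (\<Sum>e\<in>K. w e i) \<noteq> 0))"
proof -
  have inj: "inj_on ((!) ls) {..<dim_col A}"
    using ls by (simp add: inj_on_nth)
  have sums: "(\<Sum>e\<in>(!) ls ` K. w e i) = (\<Sum>j\<in>K. col A j $ i)"
    if "K \<subseteq> {..<dim_col A}" "i < dim_row A" for K i
  proof -
    have "(\<Sum>e\<in>(!) ls ` K. w e i) = (\<Sum>j\<in>K. w (ls ! j) i)"
      using inj_on_subset[OF inj that(1)] by (simp add: sum.reindex)
    also have "\<dots> = (\<Sum>j\<in>K. col A j $ i)"
      using that by (intro sum.cong) (auto simp: w subset_iff)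
    finally show ?thesis .
  qed
  have key: "(\<forall>K\<subseteq>J. K \<noteq> {} \<longrightarrow> (\<exists>i<dim_row A. (\<Sum>j\<in>K. col A j $ i) \<noteq> 0)) \<longleftrightarrow>
     (\<forall>K\<subseteq>(!) ls ` J. K \<noteq> {} \<longrightarrow> (\<exists>i<dim_row A. (\<Sum>e\<in>K. w e i) \<noteq> 0))"
    if J: "J \<subseteq> {..<dim_col A}" for J
  proof -
    have "(\<exists>i<dim_row A. (\<Sum>e\<in>(!) ls ` K. w e i) \<noteq> 0) \<longleftrightarrow>
        (\<exists>i<dim_row A. (\<Sum>j\<in>K. col A j $ i) \<noteq> 0)"
      if "K \<subseteq> J" for K
      using sums[of K] that J by auto
    then show ?thesis unfolding all_subset_image image_is_empty by blast
  qed
  have set_ls: "set ls = (!) ls ` {..<dim_col A}"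
    using ls by (auto simp: set_conv_nth)
  have "X \<in> indep (vector_matroid A ls) \<longleftrightarrow>
    (\<exists>J\<subseteq>{..<dim_col A}. X = (!) ls ` J \<and>
      (\<forall>K\<subseteq>J. K \<noteq> {} \<longrightarrow> (\<exists>i<dim_row A. (\<Sum>j\<in>K. col A j $ i) \<noteq> 0)))"
    unfolding vector_matroid_def using bit_cols_independent_iff[of _ A]
    by (simp only: indep_system.select_convs mem_Collect_eq) blast
  also have "\<dots> \<longleftrightarrow> (\<exists>J\<subseteq>{..<dim_col A}. X = (!) ls ` J \<and>
      (\<forall>K\<subseteq>X. K \<noteq> {} \<longrightarrow> (\<exists>i<dim_row A. (\<Sum>e\<in>K. w e i) \<noteq> 0)))"
    using key by (intro ex_cong1 conj_cong refl) (simp only:)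
  also have "\<dots> \<longleftrightarrow> X \<subseteq> set ls \<and>
      (\<forall>K\<subseteq>X. K \<noteq> {} \<longrightarrow> (\<exists>i<dim_row A. (\<Sum>e\<in>K. w e i) \<noteq> 0))"
    unfolding set_ls subset_image_iff by blast
  finally show ?thesis .
qed

section \<open>Parity of symmetric differences; circuits and independence\<close>

lemma even_card_sym_diff:
  assumes "finite A" "finite B"
  shows "even (card (sym_diff A B)) \<longleftrightarrow> even (card A + card B)"
proof -
  have "card (sym_diff A B) = card (A - B) + card (B - A)"
    using assms by (intro card_Un_disjoint) auto
  moreover have "card A = card (A \<inter> B) + card (A - B)" "card B = card (A \<inter> B) + card (B - A)"
    using card_Int_Diff[OF assms(1), of B] card_Int_Diff[OF assms(2), of A] by (simp_all add: Int_commute)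
  ultimately show ?thesis by (simp only: even_add) blast
qed

text \<open>By finiteness a dependent set contains an inclusion-minimal dependent set, which is a
  circuit. This is how the circuits determine the matroid.\<close>

lemma (in matroid) indep_iff_no_circuit:
  "X \<in> indep M \<longleftrightarrow> X \<subseteq> ground M \<and> (\<forall>C\<in>circuits M. \<not> C \<subseteq> X)"
proof
  assume "X \<in> indep M"
  then show "X \<subseteq> ground M \<and> (\<forall>C\<in>circuits M. \<not> C \<subseteq> X)"
    using indep_subset indep_downward by (auto simp: circuits_def)
next
  assume X: "X \<subseteq> ground M \<and> (\<forall>C\<in>circuits M. \<not> C \<subseteq> X)"
  show "X \<in> indep M"
  proof (rule ccontr)
    assume "X \<notin> indep M"
    moreover have "finite X" using X finite_ground finite_subset by blast
    ultimately obtain C where C: "C \<subseteq> X" "C \<notin> indep M"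
        "\<And>D. D \<subseteq> X \<Longrightarrow> D \<notin> indep M \<Longrightarrow> D \<subseteq> C \<Longrightarrow> C = D"
      using finite_has_minimal2[of "{D. D \<subseteq> X \<and> D \<notin> indep M}" X] by auto
    then have "D \<in> indep M" if "D \<subset> C" for D
      using that by blast
    then have "C \<in> circuits M" using C X by (auto simp: circuits_def)
    with X C show False by blast
  qed
qed

section \<open>The labelled ground set of a spike\<close>

locale spike_labelling =
  fixes r :: nat and x y :: "nat \<Rightarrow> 'a" and t :: 'a
  assumes rank_ge_3: "r \<ge> 3"
    and distinct_labels: "distinct (spike_labels r x y t)"
begin

abbreviation "E \<equiv> spike_ground r x y t"
abbreviation "Y \<equiv> y ` {1..r}"

text \<open>The side conditions are memberships in \<open>{1..r}\<close>; many later calls remove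
  \<open>atLeastAtMost_iff\<close> from the simpset to keep such memberships in this form.\<close>

lemma label_simps [simp]:
  assumes "i \<in> {1..r}"
  shows "x i \<noteq> t" "t \<noteq> x i" "y i \<noteq> t" "t \<noteq> y i"
    "j \<in> {1..r} \<Longrightarrow> x i = x j \<longleftrightarrow> i = j" "j \<in> {1..r} \<Longrightarrow> y i = y j \<longleftrightarrow> i = j"
    "j \<in> {1..r} \<Longrightarrow> x i \<noteq> y j" "j \<in> {1..r} \<Longrightarrow> y j \<noteq> x i"
proof -
  have "inj_on x {1..r}" "inj_on y {1..r}" "x ` {1..r} \<inter> y ` {1..r} = {}" "t \<notin> x ` {1..r}" "t \<notin> y ` {1..r}"
    using distinct_labels
    by (auto simp: spike_labels_def distinct_map atLeastLessThanSuc_atLeastAtMost simp del: upt_Suc)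
  then show "x i \<noteq> t" "t \<noteq> x i" "y i \<noteq> t" "t \<noteq> y i"
    "j \<in> {1..r} \<Longrightarrow> x i = x j \<longleftrightarrow> i = j" "j \<in> {1..r} \<Longrightarrow> y i = y j \<longleftrightarrow> i = j"
    "j \<in> {1..r} \<Longrightarrow> x i \<noteq> y j" "j \<in> {1..r} \<Longrightarrow> y j \<noteq> x i"
    using assms by (blast dest: inj_onD)+
qed

lemma set_spike_labels: "set (spike_labels r x y t) = E"
  by (auto simp: spike_labels_def spike_ground_def simp del: upt_Suc)

lemma finite_ground [simp]: "finite E"
  by (simp add: spike_ground_def)

lemma finite_subset_ground: "Z \<subseteq> E \<Longrightarrow> finite Z"
  by (rule finite_subset[OF _ finite_ground])

lemma in_ground [simp]: "t \<in> E" "i \<in> {1..r} \<Longrightarrow> x i \<in> E" "i \<in> {1..r} \<Longrightarrow> y i \<in> E"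
  by (auto simp: spike_ground_def)

lemma ground_cases:
  assumes "e \<in> E"
  obtains "e = t" | i where "i \<in> {1..r}" "e = x i" | i where "i \<in> {1..r}" "e = y i"
  using assms by (auto simp: spike_ground_def)

lemma Y_iff [simp]: "t \<notin> Y" "i \<in> {1..r} \<Longrightarrow> x i \<notin> Y"
  by (auto simp del: atLeastAtMost_iff)

text \<open>The pairs \<open>{x i, y i}\<close> together with \<open>{t}\<close> partition
  \<open>E\<close>.\<close>

lemma card_eq_sum_pairs:
  assumes "Z \<subseteq> E"
  shows "card Z = (\<Sum>i\<in>{1..r}. card (Z \<inter> {x i, y i})) + of_bool (t \<in> Z)"
proof -
  have fin: "finite Z" using assms by (rule finite_subset_ground)
  have "Z = (\<Union>i\<in>{1..r}. Z \<inter> {x i, y i}) \<union> (Z \<inter> {t})"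
    using assms unfolding spike_ground_def by blast
  then have "card Z = card ((\<Union>i\<in>{1..r}. Z \<inter> {x i, y i}) \<union> (Z \<inter> {t}))"
    by (rule arg_cong)
  also have "\<dots> = card (\<Union>i\<in>{1..r}. Z \<inter> {x i, y i}) + card (Z \<inter> {t})"
    using fin by (intro card_Un_disjoint) (auto simp del: atLeastAtMost_iff)
  also have "card (\<Union>i\<in>{1..r}. Z \<inter> {x i, y i}) = (\<Sum>i\<in>{1..r}. card (Z \<inter> {x i, y i}))"
    using fin by (intro card_UN_disjoint) (auto simp del: atLeastAtMost_iff)
  finally show ?thesis by (simp add: Int_insert_right)
qed

section \<open>The families \<open>phi3\<close> and \<open>phi4\<close>\<close>

text \<open>The common shape of the members of \<open>phi3\<close> and \<open>phi4\<close>.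
  Membership of \<open>t\<close> is left open, as it is what separates the two families, together
  with the parity of the intersection with \<open>Y\<close>.\<close>

definition meets_pairs_once :: "'a set \<Rightarrow> bool" where
  "meets_pairs_once Z \<longleftrightarrow> Z \<subseteq> E \<and> (\<forall>i\<in>{1..r}. x i \<in> Z \<longleftrightarrow> y i \<notin> Z)"

lemma card_pair_eq_1_iff:
  "i \<in> {1..r} \<Longrightarrow> card (Z \<inter> {x i, y i}) = 1 \<longleftrightarrow> (x i \<in> Z \<longleftrightarrow> y i \<notin> Z)"
  by (auto simp: Int_insert_right simp del: atLeastAtMost_iff)

lemma card_meets_pairs_once:
  assumes "meets_pairs_once Z"
  shows "card Z = r + of_bool (t \<in> Z)"
proof -
  have "(\<Sum>i\<in>{1..r}. card (Z \<inter> {x i, y i})) = (\<Sum>i\<in>{1..r}. 1)"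
    using assms card_pair_eq_1_iff by (intro sum.cong) (auto simp: meets_pairs_once_def)
  then show ?thesis
    using card_eq_sum_pairs[of Z] assms by (simp add: meets_pairs_once_def)
qed

text \<open>For a set meeting every pair once, having \<open>r\<close> elements amounts to avoiding
  the tip.\<close>

lemma phi3_iff: "Z \<in> phi3 r x y t \<longleftrightarrow> meets_pairs_once Z \<and> t \<notin> Z \<and> odd (card (Z \<inter> Y))"
  using card_meets_pairs_once[of Z] card_pair_eq_1_iff[of _ Z]
  by (auto simp: phi3_def meets_pairs_once_def)

text \<open>Complementation replaces the count \<open>c\<close> of elements in \<open>Y\<close> by
  \<open>r - c\<close>, and the symmetric difference adds the count of \<open>P\<close> modulo
  2.\<close>

lemma card_Int_Y_complement_sym_diff:
  assumes "C \<subseteq> E" "P \<subseteq> E"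
  shows "even (card (sym_diff (E - C) P \<inter> Y)) \<longleftrightarrow> even (r + card (C \<inter> Y) + card (P \<inter> Y))"
proof -
  have fin: "finite C" "finite P" using assms finite_subset_ground by blast+
  have "inj_on y {1..r}" by (auto simp: inj_on_def simp del: atLeastAtMost_iff)
  then have cY: "card Y = r" by (simp add: card_image)
  have YE: "Y \<subseteq> E" by (auto simp: spike_ground_def)
  have "card ((E - C) \<inter> Y) + card (C \<inter> Y) = card (((E - C) \<inter> Y) \<union> (C \<inter> Y))"
    using fin by (intro card_Un_disjoint[symmetric]) auto
  also have "((E - C) \<inter> Y) \<union> (C \<inter> Y) = Y" using YE by blast
  finally have 1: "card ((E - C) \<inter> Y) + card (C \<inter> Y) = r" using cY by simp
  let ?A = "(E - C) \<inter> Y" and ?B = "P \<inter> Y"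
  have "even r \<longleftrightarrow> even (card ?A + card (C \<inter> Y))"
    unfolding 1 ..
  moreover have "even (card (sym_diff ?A ?B)) \<longleftrightarrow> even (card ?A + card ?B)"
    using fin by (intro even_card_sym_diff) auto
  moreover have "sym_diff (E - C) P \<inter> Y = sym_diff ?A ?B" by blast
  ultimately show ?thesis by (simp only: even_add) blast
qed

text \<open>Complementing the pair with index \<open>r - 1\<close> corrects the parity when \<open>r\<close> is even.\<close>

lemma phi4_iff: "Z \<in> phi4 r x y t \<longleftrightarrow> meets_pairs_once Z \<and> t \<in> Z \<and> even (card (Z \<inter> Y))"
proof -
  \<comment> \<open>Taking \<open>P\<close> empty for odd \<open>r\<close> merges both cases of
    \<open>phi4\<close>. It contains one element of \<open>Y\<close> exactly when \<open>r\<close>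
    is even, whence the odd sum in \<open>cP\<close>.\<close>
  define P where "P = (if odd r then {} else {x (r - 1), y (r - 1)})"
  let ?h = "\<lambda>C. sym_diff (E - C) P"
  have r1: "r - 1 \<in> {1..r}" using rank_ge_3 by auto
  have PE: "P \<subseteq> E" using r1 by (auto simp: P_def simp del: atLeastAtMost_iff)
  have cP: "odd (r + card (P \<inter> Y))"
    using r1 by (auto simp: P_def Int_insert_left simp del: atLeastAtMost_iff)
  have phi4: "phi4 r x y t = ?h ` phi3 r x y t"
    by (auto simp: phi4_def P_def)
  have Pi: "x i \<in> P \<longleftrightarrow> y i \<in> P" if "i \<in> {1..r}" for i
    using that r1 by (auto simp: P_def simp del: atLeastAtMost_iff)
  have Pt: "t \<notin> P" using r1 by (auto simp: P_def simp del: atLeastAtMost_iff)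
  \<comment> \<open>On sets meeting every pair once, \<open>?h\<close> is an involution that toggles
    the tip and flips the parity of the intersection with \<open>Y\<close>; this yields both
    inclusions below.\<close>
  have h: "meets_pairs_once (?h C)" "t \<in> ?h C \<longleftrightarrow> t \<notin> C"
      "even (card (?h C \<inter> Y)) \<longleftrightarrow> odd (card (C \<inter> Y))" "?h (?h C) = C"
    if C: "meets_pairs_once C" for C
  proof -
    have CE: "C \<subseteq> E" using C by (simp add: meets_pairs_once_def)
    show "meets_pairs_once (?h C)"
      using C Pi PE in_ground by (auto simp: meets_pairs_once_def simp del: atLeastAtMost_iff)
    show "t \<in> ?h C \<longleftrightarrow> t \<notin> C" using Pt by auto
    show "even (card (?h C \<inter> Y)) \<longleftrightarrow> odd (card (C \<inter> Y))"
      using cP unfolding card_Int_Y_complement_sym_diff[OF CE PE] even_add by blast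
    show "?h (?h C) = C" using CE PE by blast
  qed
  show ?thesis
  proof
    assume "Z \<in> phi4 r x y t"
    then obtain C where C: "C \<in> phi3 r x y t" "Z = ?h C"
      unfolding phi4 by (rule imageE)
    show "meets_pairs_once Z \<and> t \<in> Z \<and> even (card (Z \<inter> Y))"
      using C(1) h(1-3)[of C] unfolding C(2) phi3_iff by (simp only: simp_thms)
  next
    assume Z: "meets_pairs_once Z \<and> t \<in> Z \<and> even (card (Z \<inter> Y))"
    then have "?h Z \<in> phi3 r x y t" using h(1-3)[of Z] unfolding phi3_iff by (simp only: simp_thms)
    then show "Z \<in> phi4 r x y t" unfolding phi4 using h(4)[of Z] Z by (intro image_eqI[of Z ?h "?h Z"]) simp_all
  qed
qed

section \<open>Prescribed circuits and zero-sum sets of columns\<close>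

abbreviation prescribed :: "'a set set" where
  "prescribed \<equiv> spike_legs r x y t \<union> spike_leg_pairs r x y \<union> phi3 r x y t \<union> phi4 r x y t"

text \<open>The row conditions for the columns labelled by \<open>K\<close> to sum to zero, written
  as parities of natural numbers. The element \<open>y i\<close> counts twice in row
  \<open>i\<close>: for its unit vector, and within \<open>card (K \<inter> Y)\<close> for its
  all-ones vector.\<close>

definition zero_sum :: "'a set \<Rightarrow> bool" where
  "zero_sum K \<longleftrightarrow> (\<forall>i\<in>{1..r}. even (of_bool (x i \<in> K) + of_bool (y i \<in> K) +
      card (K \<inter> Y) + of_bool (t \<in> K) :: nat))"

lemma leg_pairE:
  assumes "C \<in> spike_leg_pairs r x y"
  obtains i j where "i \<in> {1..r}" "j \<in> {1..r}" "i \<noteq> j" "C = {x i, y i, x j, y j}"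
proof -
  from assms obtain i j where "1 \<le> i" "i < j" "j \<le> r" "C = {x i, y i, x j, y j}"
    unfolding spike_leg_pairs_def by blast
  then show ?thesis by (intro that[of i j]) auto
qed

lemma leg_pairI:
  assumes "i \<in> {1..r}" "j \<in> {1..r}" "i \<noteq> j"
  shows "{x i, y i, x j, y j} \<in> spike_leg_pairs r x y"
proof (cases "i < j")
  case True
  then show ?thesis using assms by (auto simp: spike_leg_pairs_def)
next
  case False
  moreover have "{x i, y i, x j, y j} = {x j, y j, x i, y i}" by auto
  ultimately show ?thesis using assms unfolding spike_leg_pairs_def
    by (smt (verit, best) atLeastAtMost_iff mem_Collect_eq nat_neq_iff)
qed

text \<open>For a leg or two pairs, \<open>card (C \<inter> Y) + of_bool (t \<in> C)\<close> is 2
  and every pair contributes 0 or 2. For \<open>phi3\<close> and \<open>phi4\<close> that number is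
  odd and every pair contributes 1.\<close>

lemma prescribed_zero_sum:
  assumes "C \<in> prescribed"
  shows "C \<subseteq> E" "C \<noteq> {}" "zero_sum C"
proof -
  consider (leg) k where "k \<in> {1..r}" "C = {t, x k, y k}"
    | (pair) k l where "k \<in> {1..r}" "l \<in> {1..r}" "k \<noteq> l" "C = {x k, y k, x l, y l}"
    | (phi3) "C \<in> phi3 r x y t" | (phi4) "C \<in> phi4 r x y t"
    using assms by (auto simp: spike_legs_def elim!: leg_pairE simp del: atLeastAtMost_iff)
  then have "C \<subseteq> E \<and> C \<noteq> {} \<and> zero_sum C"
  proof cases
    case leg
    then have "C \<inter> Y = {y k}" by (auto simp: Int_insert_left simp del: atLeastAtMost_iff)
    then show ?thesis using leg by (auto simp: zero_sum_def simp del: atLeastAtMost_iff)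
  next
    case pair
    then have "C \<inter> Y = {y k, y l}" by (auto simp: Int_insert_left simp del: atLeastAtMost_iff)
    then show ?thesis using pair by (auto simp: zero_sum_def simp del: atLeastAtMost_iff)
  next
    case phi3
    then show ?thesis
      unfolding phi3_iff meets_pairs_once_def zero_sum_def by (auto simp del: atLeastAtMost_iff)
  next
    case phi4
    then show ?thesis
      unfolding phi4_iff meets_pairs_once_def zero_sum_def by (auto simp del: atLeastAtMost_iff)
  qed
  then show "C \<subseteq> E" "C \<noteq> {}" "zero_sum C" by auto
qed

text \<open>With \<open>prescribed_zero_sum\<close>, containing a nonempty zero-sum set becomes
  equivalent to containing a prescribed set.\<close>

lemma zero_sum_contains_prescribed:
  assumes K: "K \<subseteq> E" "K \<noteq> {}" "zero_sum K"
  shows "\<exists>C\<in>prescribed. C \<subseteq> K"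
\<comment> \<open>The split is on the parity of the part common to all rows. If it is odd, the case
  \<open>False\<close>, each row forces exactly one of \<open>x i\<close>, \<open>y i\<close> into
  \<open>K\<close>.\<close>
proof (cases "odd (card (K \<inter> Y)) \<longleftrightarrow> t \<in> K")
  case False
  then have "meets_pairs_once K"
    using K by (auto simp: zero_sum_def meets_pairs_once_def simp del: atLeastAtMost_iff)
  with False have "K \<in> prescribed" using phi3_iff phi4_iff by blast
  then show ?thesis by blast
next
  case True
  then have pairs: "x i \<in> K \<longleftrightarrow> y i \<in> K" if "i \<in> {1..r}" for i
    using K that by (auto simp: zero_sum_def simp del: atLeastAtMost_iff)
  have "K \<inter> Y \<noteq> {}"
  proof
    assume empty: "K \<inter> Y = {}"
    then have "t \<notin> K" using True by simp
    moreover have "y i \<notin> K" if "i \<in> {1..r}" for i using that empty by blast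
    ultimately show False using K(1,2) pairs ground_cases by (metis ex_in_conv subsetD)
  qed
  then obtain i where i: "i \<in> {1..r}" "y i \<in> K" by blast
  show ?thesis
  proof (cases "t \<in> K")
    case True
    then have "{t, x i, y i} \<subseteq> K" using i pairs by auto
    moreover have "{t, x i, y i} \<in> spike_legs r x y t" using i by (auto simp: spike_legs_def)
    ultimately show ?thesis by blast
  next
    case False
    then have "even (card (K \<inter> Y))" using \<open>odd (card (K \<inter> Y)) \<longleftrightarrow> t \<in> K\<close> by simp
    \<comment> \<open>A singleton has odd size, so a second full pair must occur.\<close>
    then have "K \<inter> Y \<noteq> {y i}" by auto
    then obtain j where "j \<in> {1..r}" "y j \<in> K" "y j \<noteq> y i" using i by blast
    then have "{x i, y i, x j, y j} \<subseteq> K" "{x i, y i, x j, y j} \<in> spike_leg_pairs r x y"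
      using i pairs leg_pairI by auto
    then show ?thesis by blast
  qed
qed

section \<open>The columns of the binary spike matrix\<close>

text \<open>Rows are numbered from 0 and labels from 1, so row \<open>i\<close> belongs to the pair \<open>x (Suc i), y (Suc i)\<close>.\<close>

definition spike_column :: "'a \<Rightarrow> nat \<Rightarrow> bit" where
  "spike_column e i = of_bool (e = x (Suc i)) + of_bool (e = y (Suc i)) + of_bool (e \<in> Y) + of_bool (e = t)"

lemma dim_binary_spike_mat [simp]:
  "dim_row (binary_spike_mat r) = r" "dim_col (binary_spike_mat r) = 2 * r + 1"
  by (auto simp: binary_spike_mat_def)

text \<open>The three blocks are checked separately. In the middle one \<open>-1 = 1\<close> turns a
  column of \<open>J - I\<close> into a unit vector plus the all-ones vector.\<close>

lemma binary_spike_mat_index: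
  assumes i: "i < r" and j: "j < 2 * r + 1"
  shows "spike_column (spike_labels r x y t ! j) i = binary_spike_mat r $$ (i, j)"
proof -
  let ?I = "1\<^sub>m r :: bit mat" and ?J = "mat r r (\<lambda>_. 1) :: bit mat"
  have M: "binary_spike_mat r $$ (i, j) =
      (cols ?I @ cols (?J - ?I) @ [vec r (\<lambda>_. 1)]) ! j $ i"
    unfolding binary_spike_mat_def using assms by (intro mat_of_cols_index) auto
  have S: "Suc i \<in> {1..r}" using i by simp
  consider "j < r" | "r \<le> j" "j < 2 * r" | "j = 2 * r" using j by linarith
  then show ?thesis
  proof cases
    case 1
    then have "spike_labels r x y t ! j = x (Suc j)"
      by (simp add: spike_labels_def nth_append del: upt_Suc)
    moreover have "Suc j \<in> {1..r}" using 1 by simp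
    ultimately show ?thesis
      using 1 i S by (auto simp: M nth_append spike_column_def simp del: atLeastAtMost_iff)
  next
    case 2
    then have "spike_labels r x y t ! j = y (Suc (j - r))"
      by (simp add: spike_labels_def nth_append del: upt_Suc)
    moreover have "Suc (j - r) \<in> {1..r}" using 2 by auto
    ultimately show ?thesis
      using 2 i S by (auto simp: M nth_append spike_column_def simp del: atLeastAtMost_iff)
  next
    case 3
    then have "spike_labels r x y t ! j = t"
      by (simp add: spike_labels_def nth_append del: upt_Suc)
    then show ?thesis
      using 3 i S M by (auto simp: nth_append spike_column_def simp del: atLeastAtMost_iff)
  qed
qed

text \<open>Each summand of \<open>spike_column\<close> is an indicator, and a sum of indicators in
  GF(2) is the parity of the set indicated.\<close>

lemma sum_spike_column_eq_0_iff:
  assumes "K \<subseteq> E"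
  shows "(\<forall>i<r. (\<Sum>e\<in>K. spike_column e i) = 0) \<longleftrightarrow> zero_sum K"
proof -
  have fin: "finite K" using assms by (rule finite_subset_ground)
  have count: "(\<Sum>e\<in>K. of_bool (P e)) = (of_nat (card {e\<in>K. P e}) :: bit)" for P
    using fin by (simp add: of_bool_def sum.If_cases Int_def)
  have single: "card {e\<in>K. e = a} = of_bool (a \<in> K)" for a
  proof -
    have "{e\<in>K. e = a} = (if a \<in> K then {a} else {})" by auto
    then show ?thesis by simp
  qed
  have "(\<Sum>e\<in>K. spike_column e i) = of_nat (of_bool (x (Suc i) \<in> K) + of_bool (y (Suc i) \<in> K) +
      card (K \<inter> Y) + of_bool (t \<in> K))" for i
    unfolding spike_column_def sum.distrib count single of_nat_add by (simp only: Int_def mem_Collect_eq)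
  moreover have "(of_nat n :: bit) = 0 \<longleftrightarrow> even n" for n
    by (induction n) auto
  ultimately have "(\<forall>i<r. (\<Sum>e\<in>K. spike_column e i) = 0) \<longleftrightarrow>
     (\<forall>i<r. even (of_bool (x (Suc i) \<in> K) + of_bool (y (Suc i) \<in> K) +
      card (K \<inter> Y) + of_bool (t \<in> K) :: nat))" by presburger
  also have "\<dots> \<longleftrightarrow> zero_sum K"
    unfolding zero_sum_def image_Suc_lessThan[symmetric] by (simp only: ball_simps lessThan_iff) blast
  finally show ?thesis .
qed

text \<open>The right-hand side is the description that \<open>indep_iff_no_circuit\<close> gives
  for a matroid on \<open>E\<close> with circuit set \<open>prescribed\<close>.\<close>

lemma indep_binary_spike_iff:
  "X \<in> indep (binary_spike r x y t) \<longleftrightarrow> X \<subseteq> E \<and> (\<forall>C\<in>prescribed. \<not> C \<subseteq> X)"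
proof -
  have "length (spike_labels r x y t) = dim_col (binary_spike_mat r)"
    by (simp add: spike_labels_def del: upt_Suc)
  then have "X \<in> indep (binary_spike r x y t) \<longleftrightarrow>
      X \<subseteq> E \<and> (\<forall>K\<subseteq>X. K \<noteq> {} \<longrightarrow> (\<exists>i<r. (\<Sum>e\<in>K. spike_column e i) \<noteq> 0))"
    unfolding binary_spike_def
    using indep_bit_vector_matroid_iff[of "spike_labels r x y t" "binary_spike_mat r" spike_column X]
      distinct_labels binary_spike_mat_index set_spike_labels by auto
  also have "\<dots> \<longleftrightarrow> X \<subseteq> E \<and> (\<forall>K\<subseteq>X. K \<noteq> {} \<longrightarrow> \<not> zero_sum K)"
    using sum_spike_column_eq_0_iff by (meson subset_trans)
  also have "\<dots> \<longleftrightarrow> X \<subseteq> E \<and> (\<forall>C\<in>prescribed. \<not> C \<subseteq> X)"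
    using prescribed_zero_sum zero_sum_contains_prescribed by (meson subset_trans)
  finally show ?thesis .
qed

section \<open>The conditions defining a spike\<close>

lemma phi3_subset_transversals: "phi3 r x y t \<subseteq> spike_transversals r x y"
proof
  fix Z assume "Z \<in> phi3 r x y t"
  then have Z: "Z \<subseteq> E" "\<forall>i\<in>{1..r}. x i \<in> Z \<longleftrightarrow> y i \<notin> Z" "t \<notin> Z"
    by (auto simp: phi3_iff meets_pairs_once_def simp del: atLeastAtMost_iff)
  define z where "z i = (if x i \<in> Z then x i else y i)" for i
  have "z ` {1..r} \<subseteq> Z" using Z by (auto simp: z_def simp del: atLeastAtMost_iff)
  moreover have "e \<in> z ` {1..r}" if "e \<in> Z" for e
  proof -
    have "e \<in> E" "e \<noteq> t" using that Z(1,3) by auto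
    then obtain i where "i \<in> {1..r}" "e = x i \<or> e = y i"
      unfolding spike_ground_def by blast
    then show ?thesis using Z that by (intro image_eqI[of _ _ i]) (auto simp: z_def simp del: atLeastAtMost_iff)
  qed
  ultimately have "Z = z ` {1..r}" by blast
  moreover have "\<forall>i\<in>{1..r}. z i \<in> {x i, y i}" by (simp add: z_def)
  ultimately show "Z \<in> spike_transversals r x y" unfolding spike_transversals_def by blast
qed

text \<open>Two odd transversals differ on an even number of pairs, hence on at least two.\<close>

lemma card_Int_phi3_le:
  assumes Z: "Z \<in> phi3 r x y t" and Z': "Z' \<in> phi3 r x y t" and ne: "Z \<noteq> Z'"
  shows "card (Z \<inter> Z') \<le> r - 2"
proof -
  note props = Z[unfolded phi3_iff meets_pairs_once_def] Z'[unfolded phi3_iff meets_pairs_once_def]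
  \<comment> \<open>The indices of the pairs on which \<open>Z\<close> and \<open>Z'\<close> choose
    differently.\<close>
  define D where "D = {i\<in>{1..r}. y i \<in> Z \<longleftrightarrow> y i \<notin> Z'}"
  have same: "e \<in> Z \<longleftrightarrow> e \<in> Z'"
    if "e \<in> E" "\<And>i. i \<in> D \<Longrightarrow> e \<noteq> x i \<and> e \<noteq> y i" for e
    using that(1)
  proof (cases rule: ground_cases)
    case 1 then show ?thesis using props by blast
  next
    case (2 i) then have "i \<notin> D" using that(2) by blast
    with 2 show ?thesis using props by (auto simp: D_def simp del: atLeastAtMost_iff)
  next
    case (3 i) then have "i \<notin> D" using that(2) by blast
    with 3 show ?thesis using props by (auto simp: D_def simp del: atLeastAtMost_iff)
  qed
  have "D \<noteq> {}" using same props ne by blast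
  then obtain i where i: "i \<in> D" by blast
  have iI: "i \<in> {1..r}" using i by (simp add: D_def)
  \<comment> \<open>A single difference would make the sizes of \<open>Z \<inter> Y\<close> and
    \<open>Z' \<inter> Y\<close> differ by one, although both are odd.\<close>
  have "D \<noteq> {i}"
  proof
    assume D: "D = {i}"
    have fin: "finite (Z \<inter> Y)" "finite (Z' \<inter> Y)" by auto
    have eq: "(Z \<inter> Y) - {y i} = (Z' \<inter> Y) - {y i}"
      using D iI by (auto simp: D_def simp del: atLeastAtMost_iff)
    show False
    proof (cases "y i \<in> Z")
      case True
      then have "y i \<notin> Z'" using i by (simp add: D_def)
      then have "card (Z \<inter> Y) = Suc (card (Z' \<inter> Y))"
        using eq True iI card.remove[OF fin(1), of "y i"] by simp
      then show False using props by simp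
    next
      case False
      then have "y i \<in> Z'" using i by (simp add: D_def)
      then have "card (Z' \<inter> Y) = Suc (card (Z \<inter> Y))"
        using eq False iI card.remove[OF fin(2), of "y i"] by simp
      then show False using props by simp
    qed
  qed
  then obtain j where j: "j \<in> D" "j \<noteq> i" using i by blast
  have jI: "j \<in> {1..r}" using j by (simp add: D_def)
  \<comment> \<open>The element that \<open>Z\<close> chooses from pair \<open>k\<close>; two
    indices in \<open>D\<close> give two elements of \<open>Z\<close> outside
    \<open>Z'\<close>.\<close>
  define z where "z k = (if x k \<in> Z then x k else y k)" for k
  have zz: "z k \<in> Z" "z k \<notin> Z'" if "k \<in> D" for k
    using that props by (auto simp: D_def z_def simp del: atLeastAtMost_iff)
  have "z i \<noteq> z j" using iI jI j by (auto simp: z_def simp del: atLeastAtMost_iff)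
  moreover have "Z \<inter> Z' \<subseteq> Z - {z i, z j}" using zz i j by blast
  moreover have "finite Z" using props finite_subset_ground by blast
  ultimately have "card (Z \<inter> Z') \<le> card Z - card {z i, z j}"
    using zz(1)[OF i] zz(1)[OF j(1)]
    by (metis card_Diff_subset card_mono empty_subsetI finite.emptyI finite.insertI finite_Diff insert_subset)
  moreover have "card Z = r" using Z by (simp add: phi3_def)
  ultimately show ?thesis using \<open>z i \<noteq> z j\<close> by simp
qed

lemma card_pair_le_1_iff:
  "i \<in> {1..r} \<Longrightarrow> card (Z \<inter> {x i, y i}) \<le> 1 \<longleftrightarrow> \<not> {x i, y i} \<subseteq> Z"
  by (auto simp: Int_insert_right simp del: atLeastAtMost_iff)

lemma sum_le_1_eq_card_imp_eq_1:
  fixes f :: "'b \<Rightarrow> nat"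
  assumes "finite I" "\<And>i. i \<in> I \<Longrightarrow> f i \<le> 1" "sum f I = card I" "i \<in> I"
  shows "f i = 1"
proof (rule ccontr)
  assume "f i \<noteq> 1"
  with assms(2)[OF assms(4)] have "f i < 1" by simp
  with assms have "sum f I < sum (\<lambda>_. 1) I" by (intro sum_strict_mono_ex1) auto
  then show False using assms(3) by simp
qed

text \<open>
  A set of \<open>r + 1\<close> elements avoiding the tip and all unions of two pairs consists of one pair
  \<open>{x k, y k}\<close> and one element of each other pair; dropping \<open>x k\<close> or \<open>y k\<close> gives an odd transversal.
\<close>

lemma spike_rest_phi3: "spike_rest r x y t (phi3 r x y t) = phi4 r x y t"
proof (intro subset_antisym subsetI)
  fix Z assume "Z \<in> spike_rest r x y t (phi3 r x y t)"
  then have ZE: "Z \<subseteq> E" and cZ: "card Z = r + 1"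
    and free: "\<And>D. D \<in> spike_legs r x y t \<union> spike_leg_pairs r x y \<union> phi3 r x y t \<Longrightarrow> \<not> D \<subseteq> Z"
    by (auto simp: spike_rest_def)
  have fin: "finite Z" using ZE by (rule finite_subset_ground)
  note cs = card_eq_sum_pairs[OF ZE]
  have tZ: "t \<in> Z"
  proof (rule ccontr)
    assume t: "t \<notin> Z"
    \<comment> \<open>Pigeonhole: without the tip, \<open>r + 1\<close> elements lie in
      \<open>r\<close> pairs.\<close>
    have "\<exists>k\<in>{1..r}. {x k, y k} \<subseteq> Z"
    proof (rule ccontr)
      assume "\<not> ?thesis"
      then have "(\<Sum>i\<in>{1..r}. card (Z \<inter> {x i, y i})) \<le> (\<Sum>i\<in>{1..r}. 1)"
        using card_pair_le_1_iff by (intro sum_mono) blast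
      then show False using cs t cZ by simp
    qed
    then obtain k where k: "k \<in> {1..r}" "x k \<in> Z" "y k \<in> Z" by blast
    have other: "card (Z \<inter> {x i, y i}) \<le> 1" if "i \<in> {1..r} - {k}" for i
      using free[of "{x k, y k, x i, y i}"] leg_pairI[of k i] k that card_pair_le_1_iff[of i Z] by blast
    have "(\<Sum>i\<in>{1..r}. card (Z \<inter> {x i, y i})) =
        card (Z \<inter> {x k, y k}) + (\<Sum>i\<in>{1..r} - {k}. card (Z \<inter> {x i, y i}))"
      using k by (intro sum.remove) auto
    moreover have "card (Z \<inter> {x k, y k}) = 2"
      using k by (simp add: Int_insert_right del: atLeastAtMost_iff)
    ultimately have sum: "(\<Sum>i\<in>{1..r} - {k}. card (Z \<inter> {x i, y i})) = card ({1..r} - {k})"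
      using cs t cZ k by simp
    have one: "x i \<in> Z \<longleftrightarrow> y i \<notin> Z" if "i \<in> {1..r} - {k}" for i
      using sum_le_1_eq_card_imp_eq_1[OF _ other sum that] card_pair_eq_1_iff[of i Z] that by blast
    have "meets_pairs_once (Z - {e})" if "e \<in> {x k, y k}" for e
      using one k that ZE by (auto simp: meets_pairs_once_def simp del: atLeastAtMost_iff)
    \<comment> \<open>The two counts are consecutive, so one of them is odd.\<close>
    moreover have "card ((Z - {x k}) \<inter> Y) = Suc (card ((Z - {y k}) \<inter> Y))"
    proof -
      have "(Z - {x k}) \<inter> Y = insert (y k) ((Z - {y k}) \<inter> Y)"
        using k by (auto simp del: atLeastAtMost_iff)
      then show ?thesis using fin by simp
    qed
    ultimately have "Z - {x k} \<in> phi3 r x y t \<or> Z - {y k} \<in> phi3 r x y t"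
      using t by (auto simp: phi3_iff simp del: atLeastAtMost_iff)
    then show False using free by blast
  qed
  \<comment> \<open>Now that the tip is present, a full pair would complete a leg; the other
    \<open>r\<close> elements are thus spread one per pair.\<close>
  have le: "card (Z \<inter> {x i, y i}) \<le> 1" if "i \<in> {1..r}" for i
    using free[of "{t, x i, y i}"] that tZ card_pair_le_1_iff[of i Z] by (auto simp: spike_legs_def)
  have "(\<Sum>i\<in>{1..r}. card (Z \<inter> {x i, y i})) = card {1..r}"
    using cs tZ cZ by simp
  from sum_le_1_eq_card_imp_eq_1[OF _ le this] have mZ: "meets_pairs_once Z"
    using card_pair_eq_1_iff[of _ Z] ZE unfolding meets_pairs_once_def by blast
  have "even (card (Z \<inter> Y))"
  proof (rule ccontr)
    assume "odd (card (Z \<inter> Y))"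
    moreover have "(Z - {t}) \<inter> Y = Z \<inter> Y" using Y_iff(1) by blast
    ultimately have "Z - {t} \<in> phi3 r x y t"
      using mZ unfolding phi3_iff meets_pairs_once_def by auto
    then show False using free by blast
  qed
  then show "Z \<in> phi4 r x y t" using mZ tZ phi4_iff by blast
next
  fix Z assume Z: "Z \<in> phi4 r x y t"
  then have mZ: "Z \<subseteq> E" "\<And>i. i \<in> {1..r} \<Longrightarrow> x i \<in> Z \<longleftrightarrow> y i \<notin> Z"
    and ev: "even (card (Z \<inter> Y))"
    unfolding phi4_iff meets_pairs_once_def by blast+
  have "card Z = r + 1" using Z card_meets_pairs_once[of Z] by (simp add: phi4_iff)
  moreover have "\<not> D \<subseteq> Z" if "D \<in> spike_legs r x y t \<union> spike_leg_pairs r x y" for D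
    using that mZ(2) by (auto simp: spike_legs_def elim!: leg_pairE simp del: atLeastAtMost_iff)
  moreover have "\<not> D \<subseteq> Z" if D: "D \<in> phi3 r x y t" for D
  proof
    assume sub: "D \<subseteq> Z"
    \<comment> \<open>Both sets choose once from every pair, so inclusion forces equal choices,
      while the parities differ.\<close>
    then have "D \<inter> Y = Z \<inter> Y"
      using D mZ(2) unfolding phi3_iff meets_pairs_once_def by blast
    then show False using D ev by (simp add: phi3_iff)
  qed
  ultimately show "Z \<in> spike_rest r x y t (phi3 r x y t)"
    using mZ(1) unfolding spike_rest_def by blast
qed

end

theorem theorem5:
  fixes r :: nat and x y :: "nat \<Rightarrow> 'a" and t :: 'a and M :: "'a indep_system"
  assumes "r \<ge> 3"
    and "distinct (spike_labels r x y t)"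
    and "matroid M"
    and "ground M = spike_ground r x y t"
    and "circuits M = spike_legs r x y t \<union> spike_leg_pairs r x y \<union> phi3 r x y t \<union> phi4 r x y t"
  shows "binary_matroid M \<and> is_spike r x y t M \<and> M = binary_spike r x y t"
proof -
  interpret spike_labelling r x y t by (rule spike_labelling.intro[OF assms(1,2)])
  have "X \<in> indep M \<longleftrightarrow> X \<in> indep (binary_spike r x y t)" for X
    unfolding matroid.indep_iff_no_circuit[OF assms(3)] indep_binary_spike_iff assms(4,5) ..
  then have "indep M = indep (binary_spike r x y t)" by (rule Set.set_eqI)
  moreover have "ground M = ground (binary_spike r x y t)"
    using assms(4) set_spike_labels by (simp add: binary_spike_def vector_matroid_def)
  ultimately have M: "M = binary_spike r x y t"
    by (simp add: indep_system.equality)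
  moreover have "length (spike_labels r x y t) = dim_col (binary_spike_mat r)"
    by (simp add: spike_labels_def del: upt_Suc)
  ultimately have "binary_matroid M"
    unfolding binary_matroid_def binary_spike_def using assms(2) by blast
  moreover have "is_spike r x y t M"
    unfolding is_spike_def
  \<comment> \<open>The family of transversal circuits is \<open>phi3\<close>; the remaining
    circuits are then \<open>phi4\<close> by \<open>spike_rest_phi3\<close>.\<close>
  proof (intro conjI exI[of _ "phi3 r x y t"])
    show "\<forall>Z\<in>phi3 r x y t. \<forall>Z'\<in>phi3 r x y t. Z \<noteq> Z' \<longrightarrow> card (Z \<inter> Z') \<le> r - 2"
      using card_Int_phi3_le by blast
    show "circuits M = spike_legs r x y t \<union> spike_leg_pairs r x y \<union> phi3 r x y t \<union>
        spike_rest r x y t (phi3 r x y t)"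
      unfolding spike_rest_phi3 by (rule assms(5))
  qed (rule assms phi3_subset_transversals)+
  ultimately show ?thesis using M by blast
qed

end
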